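(* For every $n\ge 1$, the dimension of the $n$-th component of the nonsymmetric operad $\mathrm{noncom}\text{-}\mathrm{Bicom}$ is $$\dim\big(\mathrm{noncom}\text{-}\mathrm{Bicom}(n)\big)=\frac{(2n-2)!}{(n-1)!\,(n-1)!}.$$
   Context: $\mathrm{noncom}\text{-}\mathrm{Bicom}$ (the nonsymmetric bicommutative operad) is the nonsymmetric operad over a field $\Bbbk$ generated by two binary operations $\prec$ and $\succ$ subject to the relations $$x_1\succ(x_2\prec x_3)=(x_1\succ x_2)\prec x_3,\qquad x_1\prec(x_2\succ x_3)=(x_1\prec x_2)\succ x_3.$$ (Its symmetrization is the white Manin product $\mathrm{As}\circ\mathrm{Bicom}$ of the associative and bicommutative operads.) The component of arity $n$ is that of the nonsymmetric operad, i.e. the variables occur in the fixed order $x_1,\dots,x_n$. *)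

theory Defs
  imports Complex_Main "HOL-Library.Poly_Mapping"
begin

section \<open>Nonsymmetric operads presented by binary generators\<close>

text \<open>
  A planar binary tree with inner vertices labelled by generators is a monomial of the free
  nonsymmetric operad on these generators.  The leaves carry no label: read from left to right
  they stand for \<open>x\<^sub>1, \<dots>, x\<^sub>n\<close>.  The tree \<open>Leaf\<close> is the operadic unit.
\<close>

datatype 'g mon = Leaf | Node 'g "'g mon" "'g mon"

primrec arity :: "'g mon \<Rightarrow> nat" where
  "arity Leaf = 1"
| "arity (Node a l r) = arity l + arity r"

text \<open>
  \<open>graft s i t\<close> is the partial composition \<open>s \<circ>\<^sub>i t\<close> of monomials: the \<open>i\<close>-th leaf of \<open>s\<close> is
  replaced by \<open>t\<close>.  Leaves are counted from 1, and only \<open>1 \<le> i \<le> arity s\<close> is meaningful.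
\<close>

primrec graft :: "'g mon \<Rightarrow> nat \<Rightarrow> 'g mon \<Rightarrow> 'g mon" where
  "graft Leaf i t = t"
| "graft (Node a l r) i t =
     (if i \<le> arity l then Node a (graft l i t) r else Node a l (graft r (i - arity l) t))"

text \<open>
  The type \<open>('g, 'k) free_op\<close> is the direct sum over \<open>n\<close> of the components of the free operad;
  \<open>free_component n\<close> is the summand of arity \<open>n\<close>.
\<close>

type_synonym ('g, 'k) free_op = "'g mon \<Rightarrow>\<^sub>0 'k"

definition free_component :: "nat \<Rightarrow> ('g, 'k::field) free_op set" where
  "free_component n = {f. \<forall>t \<in> Poly_Mapping.keys f. arity t = n}"

definition free_scale :: "'k::field \<Rightarrow> ('g, 'k) free_op \<Rightarrow> ('g, 'k) free_op" where
  "free_scale c = Poly_Mapping.map ((*) c)"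

text \<open>The bilinear extension of \<open>graft\<close>.\<close>

definition free_comp ::
    "('g, 'k::field) free_op \<Rightarrow> nat \<Rightarrow> ('g, 'k) free_op \<Rightarrow> ('g, 'k) free_op" where
  "free_comp f i g =
     (\<Sum>s \<in> Poly_Mapping.keys f. \<Sum>t \<in> Poly_Mapping.keys g.
        Poly_Mapping.single (graft s i t) (Poly_Mapping.lookup f s * Poly_Mapping.lookup g t))"

text \<open>
  \<open>operad_ideal R n\<close> is the set of elements of arity \<open>n\<close> of the operadic ideal generated by the
  relators \<open>R\<close>, where \<open>R m \<subseteq> free_component m\<close> is the set of relators of arity \<open>m\<close>.
\<close>

inductive in_operad_ideal ::
    "(nat \<Rightarrow> ('g, 'k::field) free_op set) \<Rightarrow> nat \<Rightarrow> ('g, 'k) free_op \<Rightarrow> bool"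
  for R :: "nat \<Rightarrow> ('g, 'k) free_op set"
where
  relator: "f \<in> R n \<Longrightarrow> in_operad_ideal R n f"
| zero: "in_operad_ideal R n 0"
| add: "in_operad_ideal R n f \<Longrightarrow> in_operad_ideal R n g \<Longrightarrow> in_operad_ideal R n (f + g)"
| scale: "in_operad_ideal R n f \<Longrightarrow> in_operad_ideal R n (free_scale c f)"
| comp_left: "in_operad_ideal R m f \<Longrightarrow> g \<in> free_component n \<Longrightarrow> 1 \<le> i \<Longrightarrow> i \<le> m
    \<Longrightarrow> in_operad_ideal R (m + n - 1) (free_comp f i g)"
| comp_right: "f \<in> free_component m \<Longrightarrow> in_operad_ideal R n g \<Longrightarrow> 1 \<le> i \<Longrightarrow> i \<le> m
    \<Longrightarrow> in_operad_ideal R (m + n - 1) (free_comp f i g)"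

definition operad_ideal ::
    "(nat \<Rightarrow> ('g, 'k::field) free_op set) \<Rightarrow> nat \<Rightarrow> ('g, 'k) free_op set" where
  "operad_ideal R n = {f. in_operad_ideal R n f}"

lemma lookup_free_scale [simp]:
  "Poly_Mapping.lookup (free_scale c f) t = c * Poly_Mapping.lookup f t"
  unfolding free_scale_def by (transfer) (auto simp: when_def)

global_interpretation free_op: vector_space "free_scale :: 'k::field \<Rightarrow> ('g, 'k) free_op \<Rightarrow> _"
  by unfold_locales (auto intro!: poly_mapping_eqI simp: lookup_add algebra_simps)


section \<open>The nonsymmetric bicommutative operad\<close>

datatype bicom_gen = Prec | Succ

text \<open>
  The relators of
  \<open>x\<^sub>1 \<succ> (x\<^sub>2 \<prec> x\<^sub>3) = (x\<^sub>1 \<succ> x\<^sub>2) \<prec> x\<^sub>3\<close> and \<open>x\<^sub>1 \<prec> (x\<^sub>2 \<succ> x\<^sub>3) = (x\<^sub>1 \<prec> x\<^sub>2) \<succ> x\<^sub>3\<close>.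
\<close>

definition bicom_relators :: "nat \<Rightarrow> (bicom_gen, 'k::field) free_op set" where
  "bicom_relators n = (if n = 3 then
     {Poly_Mapping.single (Node Succ Leaf (Node Prec Leaf Leaf)) 1
        - Poly_Mapping.single (Node Prec (Node Succ Leaf Leaf) Leaf) 1,
      Poly_Mapping.single (Node Prec Leaf (Node Succ Leaf Leaf)) 1
        - Poly_Mapping.single (Node Succ (Node Prec Leaf Leaf) Leaf) 1}
   else {})"

text \<open>
  The type \<open>'k noncom_bicom\<close> is the direct sum over \<open>n\<close> of the components of the quotient operad:
  the quotient of the free operad by the direct sum of the components of the ideal.
\<close>

definition bicom_ideal :: "(bicom_gen, 'k::field) free_op set" where
  "bicom_ideal = free_op.span (\<Union>n. operad_ideal bicom_relators n)"

definition bicom_rel ::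
    "(bicom_gen, 'k::field) free_op \<Rightarrow> (bicom_gen, 'k) free_op \<Rightarrow> bool" where
  "bicom_rel f g \<longleftrightarrow> f - g \<in> bicom_ideal"

lemma bicom_ideal_closed:
  "0 \<in> bicom_ideal"
  "f \<in> bicom_ideal \<Longrightarrow> g \<in> bicom_ideal \<Longrightarrow> f + g \<in> bicom_ideal"
  "f \<in> bicom_ideal \<Longrightarrow> - f \<in> bicom_ideal"
  "f \<in> bicom_ideal \<Longrightarrow> free_scale c f \<in> bicom_ideal"
  unfolding bicom_ideal_def
  by (auto intro: free_op.span_zero free_op.span_add free_op.span_neg free_op.span_scale)

lemma equivp_bicom_rel:
  "equivp (bicom_rel :: (bicom_gen, 'k::field) free_op \<Rightarrow> (bicom_gen, 'k) free_op \<Rightarrow> bool)"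
proof (rule equivpI)
  show "reflp (bicom_rel :: (bicom_gen, 'k) free_op \<Rightarrow> _)"
    by (auto simp: reflp_def bicom_rel_def bicom_ideal_closed)
  show "symp (bicom_rel :: (bicom_gen, 'k) free_op \<Rightarrow> _)"
    by (rule sympI) (metis bicom_rel_def bicom_ideal_closed(3) minus_diff_eq)
  show "transp (bicom_rel :: (bicom_gen, 'k) free_op \<Rightarrow> _)"
  proof (rule transpI)
    fix f g h :: "(bicom_gen, 'k) free_op"
    assume "bicom_rel f g" "bicom_rel g h"
    then show "bicom_rel f h"
      using bicom_ideal_closed(2)[of "f - g" "g - h"] by (simp add: bicom_rel_def)
  qed
qed

quotient_type (overloaded) 'k noncom_bicom = "(bicom_gen, 'k::field) free_op" / bicom_rel
  by (rule equivp_bicom_rel)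

instantiation noncom_bicom :: (field) ab_group_add
begin

lift_definition zero_noncom_bicom :: "'a noncom_bicom" is 0 .

lift_definition plus_noncom_bicom :: "'a noncom_bicom \<Rightarrow> 'a noncom_bicom \<Rightarrow> 'a noncom_bicom"
  is "(+)"
  unfolding bicom_rel_def by (metis add_diff_add bicom_ideal_closed(2))

lift_definition uminus_noncom_bicom :: "'a noncom_bicom \<Rightarrow> 'a noncom_bicom" is uminus
  unfolding bicom_rel_def by (metis minus_diff_minus bicom_ideal_closed(3))

lift_definition minus_noncom_bicom :: "'a noncom_bicom \<Rightarrow> 'a noncom_bicom \<Rightarrow> 'a noncom_bicom"
  is "(-)"
proof -
  fix f f' g g' :: "(bicom_gen, 'a) free_op"
  assume "bicom_rel f f'" "bicom_rel g g'"
  then have "(f - f') + - (g - g') \<in> bicom_ideal"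
    unfolding bicom_rel_def by (intro bicom_ideal_closed)
  then show "bicom_rel (f - g) (f' - g')"
    by (simp add: bicom_rel_def algebra_simps)
qed

instance
proof
  fix x y z :: "'a noncom_bicom"
  have eq: "bicom_rel f g" if "f = g" for f g :: "(bicom_gen, 'a) free_op"
    using that by (simp add: bicom_rel_def bicom_ideal_closed)
  show "x + y + z = x + (y + z)" by transfer (simp add: eq add.assoc)
  show "x + y = y + x" by transfer (simp add: eq add.commute)
  show "0 + x = x" by transfer (simp add: eq)
  show "- x + x = 0" by transfer (simp add: eq)
  show "x - y = x + - y" by transfer (simp add: eq)
qed

end

lift_definition noncom_bicom_scale :: "'k::field \<Rightarrow> 'k noncom_bicom \<Rightarrow> 'k noncom_bicom"
  is free_scale
  unfolding bicom_rel_def by (metis free_op.scale_right_diff_distrib bicom_ideal_closed(4))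

global_interpretation noncom_bicom:
  vector_space "noncom_bicom_scale :: 'k::field \<Rightarrow> 'k noncom_bicom \<Rightarrow> _"
proof
  fix a b :: 'k and x y :: "'k noncom_bicom"
  have eq: "bicom_rel f g" if "f = g" for f g :: "(bicom_gen, 'k) free_op"
    using that by (simp add: bicom_rel_def bicom_ideal_closed)
  show "noncom_bicom_scale a (x + y) = noncom_bicom_scale a x + noncom_bicom_scale a y"
    by transfer (simp add: eq free_op.scale_right_distrib)
  show "noncom_bicom_scale (a + b) x = noncom_bicom_scale a x + noncom_bicom_scale b x"
    by transfer (simp add: eq free_op.scale_left_distrib)
  show "noncom_bicom_scale a (noncom_bicom_scale b x) = noncom_bicom_scale (a * b) x"
    by transfer (simp add: eq)
  show "noncom_bicom_scale 1 x = x"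
    by transfer (simp add: eq)
qed

definition noncom_bicom_component :: "nat \<Rightarrow> 'k::field noncom_bicom set" where
  "noncom_bicom_component n = abs_noncom_bicom ` free_component n"


text \<open>
  The ideal is homogeneous, so the component of arity \<open>n\<close> of the quotient is indeed
  \<open>free_component n\<close> modulo \<open>operad_ideal bicom_relators n\<close>.
\<close>

lemma arity_pos: "0 < arity t"
  by (induction t) auto

lemma arity_graft:
  "1 \<le> i \<Longrightarrow> i \<le> arity s \<Longrightarrow> arity (graft s i t) = arity s + arity t - 1"
proof (induction s arbitrary: i)
  case Leaf
  then show ?case by simp
next
  case (Node a l r)
  show ?case
  proof (cases "i \<le> arity l")
    case True
    then show ?thesis using Node arity_pos[of t] by simp
  next
    case False
    then show ?thesis
      using Node.prems Node.IH(2)[of "i - arity l"] arity_pos[of t] arity_pos[of r] by simp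
  qed
qed

lemma free_component_iff:
  "f \<in> free_component n \<longleftrightarrow> (\<forall>t. Poly_Mapping.lookup f t \<noteq> 0 \<longrightarrow> arity t = n)"
  by (auto simp: free_component_def in_keys_iff)

lemma subspace_free_component:
  "free_op.subspace (free_component n :: ('g, 'k::field) free_op set)"
proof (rule free_op.subspaceI)
  show "f + g \<in> free_component n" if "f \<in> free_component n" "g \<in> free_component n"
    for f g :: "('g, 'k) free_op"
    unfolding free_component_iff lookup_add
    using that by (metis add_0 free_component_iff)
qed (auto simp: free_component_iff)

lemma free_comp_in_component:
  assumes "f \<in> free_component m" "g \<in> free_component n" "1 \<le> i" "i \<le> m"
  shows "free_comp f i g \<in> free_component (m + n - 1)"
  unfolding free_comp_def
  using assms
  by (intro free_op.subspace_sum[OF subspace_free_component])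
    (auto simp: free_component_def arity_graft)

lemma operad_ideal_subset_component:
  assumes "\<And>m. R m \<subseteq> free_component m"
  shows "operad_ideal R n \<subseteq> free_component n"
proof -
  have "f \<in> free_component n" if "in_operad_ideal R n f" for f
    using that
  proof induction
    case (relator f n)
    then show ?case using assms by blast
  next
    case (comp_left m f g n i)
    then show ?case by (intro free_comp_in_component)
  next
    case (comp_right f m n g i)
    then show ?case by (intro free_comp_in_component)
  qed (auto intro: free_op.subspace_0 free_op.subspace_add free_op.subspace_scale
      subspace_free_component)
  then show ?thesis by (auto simp: operad_ideal_def)
qed

lemma subspace_operad_ideal: "free_op.subspace (operad_ideal R n)"
  by (rule free_op.subspaceI) (auto simp: operad_ideal_def intro: in_operad_ideal.intros)

lemma bicom_relators_subset_component: "bicom_relators n \<subseteq> free_component n"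
  by (auto simp: bicom_relators_def free_component_iff lookup_minus lookup_single when_def
      split: if_splits)

lemma abs_noncom_bicom_eq_0_iff:
  assumes "f \<in> free_component n"
  shows "abs_noncom_bicom f = 0 \<longleftrightarrow> f \<in> operad_ideal bicom_relators n"
proof
  define part :: "(bicom_gen, 'a) free_op \<Rightarrow> (bicom_gen, 'a) free_op" where
    "part h = Abs_poly_mapping (\<lambda>t. Poly_Mapping.lookup h t when arity t = n)" for h
  have lookup_part: "Poly_Mapping.lookup (part h) t = (Poly_Mapping.lookup h t when arity t = n)"
    for h t
    unfolding part_def
    by (subst lookup_Abs_poly_mapping)
      (auto intro: finite_subset[OF _ finite_lookup[of h]] simp: when_def)
  have *: "h \<in> bicom_ideal \<Longrightarrow> part h \<in> operad_ideal bicom_relators n" for h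
    unfolding bicom_ideal_def
  proof (induction h rule: free_op.span_induct_alt)
    case base
    have "part 0 = 0"
      by (rule poly_mapping_eqI) (simp add: lookup_part)
    then show ?case
      by (simp add: free_op.subspace_0 subspace_operad_ideal)
  next
    case (step c x y)
    then obtain m where m: "x \<in> operad_ideal bicom_relators m" by auto
    then have "x \<in> free_component m"
      using operad_ideal_subset_component[OF bicom_relators_subset_component] by blast
    then have "part x = (if m = n then x else 0)"
      by (intro poly_mapping_eqI) (auto simp: lookup_part when_def free_component_iff)
    with m have "part x \<in> operad_ideal bicom_relators n"
      by (auto simp: free_op.subspace_0 subspace_operad_ideal)
    moreover have "part (free_scale c x + y) = free_scale c (part x) + part y"
      by (rule poly_mapping_eqI) (auto simp: lookup_part lookup_add when_def)
    ultimately show ?case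
      using step by (simp add: free_op.subspace_add free_op.subspace_scale subspace_operad_ideal)
  qed
  assume "abs_noncom_bicom f = 0"
  then have "f \<in> bicom_ideal"
    by (simp add: zero_noncom_bicom_def noncom_bicom.abs_eq_iff bicom_rel_def)
  moreover have "part f = f"
    using assms by (intro poly_mapping_eqI) (auto simp: lookup_part when_def free_component_iff)
  ultimately show "f \<in> operad_ideal bicom_relators n"
    using * by force
next
  assume "f \<in> operad_ideal bicom_relators n"
  then show "abs_noncom_bicom f = 0"
    by (auto simp: zero_noncom_bicom_def noncom_bicom.abs_eq_iff bicom_rel_def bicom_ideal_def
        intro: free_op.span_base)
qed

lemma subspace_noncom_bicom_component: "noncom_bicom.subspace (noncom_bicom_component n)"
proof (rule noncom_bicom.subspaceI)
  show "0 \<in> noncom_bicom_component n"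
    by (auto simp: noncom_bicom_component_def zero_noncom_bicom_def
        intro!: imageI free_op.subspace_0 subspace_free_component)
  show "x + y \<in> noncom_bicom_component n"
    if "x \<in> noncom_bicom_component n" "y \<in> noncom_bicom_component n" for x y :: "'a noncom_bicom"
    using that
    by (auto simp: noncom_bicom_component_def plus_noncom_bicom.abs_eq
        intro!: imageI free_op.subspace_add subspace_free_component)
  show "noncom_bicom_scale c x \<in> noncom_bicom_component n"
    if "x \<in> noncom_bicom_component n" for c and x :: "'a noncom_bicom"
    using that
    by (auto simp: noncom_bicom_component_def noncom_bicom_scale.abs_eq
        intro!: imageI free_op.subspace_scale subspace_free_component)
qed

end

theory Submission
  imports Defs "HOL-Computational_Algebra.Formal_Power_Series"
begin

text \<open>
  Both relations rotate an edge joining two vertices with different labels, so the operad is the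
  linearization of a set operad, and the dimension is a number of classes of labelled trees.
  Rotating, one brings every tree to a form in which the left subtree of each vertex
  of the right spine carries only the label of that vertex; these forms are pairwise inequivalent.
  If \<open>C = 1 + x C\<^sup>2\<close> counts the trees with only one label, then the normal forms
  are counted by \<open>N = 1 + 2 x C N\<close>. Hence \<open>N\<^sup>2 (1 - 4 x) = 1\<close>, and differentiating
  gives \<open>(m + 1) N\<^sub>m\<^sub>+\<^sub>1 = (4 m + 2) N\<^sub>m\<close>.
\<close>

section \<open>Normal forms of trees\<close>

primrec mono_labelled :: "'g \<Rightarrow> 'g mon \<Rightarrow> bool" where
  "mono_labelled c Leaf \<longleftrightarrow> True"
| "mono_labelled c (Node a l r) \<longleftrightarrow> a = c \<and> mono_labelled c l \<and> mono_labelled c r"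

primrec normal :: "'g mon \<Rightarrow> bool" where
  "normal Leaf \<longleftrightarrow> True"
| "normal (Node a l r) \<longleftrightarrow> mono_labelled a l \<and> normal r"

text \<open>Normalizes a root \<open>a\<close> over normal subtrees: as long as the left subtree is
  not purely labelled \<open>a\<close>, its root is moved above \<open>a\<close> and
  \<open>a\<close> sinks to the right. This is done even if that root is labelled \<open>a\<close>
  itself.\<close>

primrec norm_node :: "'g \<Rightarrow> 'g mon \<Rightarrow> 'g mon \<Rightarrow> 'g mon" where
  "norm_node a Leaf r = Node a Leaf r"
| "norm_node a (Node b u s) r =
     (if mono_labelled a (Node b u s) then Node a (Node b u s) r else Node b u (norm_node a s r))"

primrec nf :: "'g mon \<Rightarrow> 'g mon" where
  "nf Leaf = Leaf"
| "nf (Node a l r) = norm_node a (nf l) (nf r)"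

inductive rot_eq :: "'g mon \<Rightarrow> 'g mon \<Rightarrow> bool" where
  refl: "rot_eq s s"
| sym: "rot_eq s t \<Longrightarrow> rot_eq t s"
| trans [trans]: "rot_eq s t \<Longrightarrow> rot_eq t u \<Longrightarrow> rot_eq s u"
| node: "rot_eq l l' \<Longrightarrow> rot_eq r r' \<Longrightarrow> rot_eq (Node a l r) (Node a l' r')"
| rotate: "a \<noteq> b \<Longrightarrow> rot_eq (Node a x (Node b y z)) (Node b (Node a x y) z)"

lemma normal_if_mono_labelled: "mono_labelled a t \<Longrightarrow> normal t"
  by (induction t) auto

lemma norm_node_mono_labelled: "mono_labelled a l \<Longrightarrow> norm_node a l r = Node a l r"
  by (cases l) auto

text \<open>The vertex \<open>a\<close> is only moved, never lost.\<close>

lemma not_mono_labelled_norm_node: "a \<noteq> b \<Longrightarrow> \<not> mono_labelled b (norm_node a l r)"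
  by (induction l) auto

text \<open>Both sides move the same vertices of the right spine of \<open>x\<close> to the top. On
  the right-hand side the test for label \<open>b\<close> always fails, because the tree tested
  still contains the vertex \<open>a\<close>.\<close>

lemma norm_node_rotate:
  assumes "a \<noteq> b"
  shows "norm_node a x (norm_node b y z) = norm_node b (norm_node a x y) z"
  using assms by (induction x) (auto simp: not_mono_labelled_norm_node)

lemma normal_norm_node: "normal l \<Longrightarrow> normal r \<Longrightarrow> normal (norm_node a l r)"
  by (induction l) auto

lemma normal_nf: "normal (nf t)"
  by (induction t) (auto simp: normal_norm_node)

lemma nf_normal: "normal t \<Longrightarrow> nf t = t"
proof (induction t)
  case (Node a l r)
  then show ?case using normal_if_mono_labelled[of a l] by (simp add: norm_node_mono_labelled)
qed simp

text \<open>Together with \<open>nf_normal\<close> this makes distinct normal trees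
  inequivalent.\<close>

lemma nf_rot_eq: "rot_eq s t \<Longrightarrow> nf s = nf t"
  by (induction rule: rot_eq.induct) (auto simp: norm_node_rotate)

lemma arity_rot_eq: "rot_eq s t \<Longrightarrow> arity s = arity t"
  by (induction rule: rot_eq.induct) auto

text \<open>If the root is labelled \<open>a\<close>, normality makes its left subtree purely
  \<open>a\<close>, so another label occurs in the right subtree. By induction it can be brought to
  the root there, and one rotation lifts it to the top.\<close>

lemma rot_eq_root_if_not_mono_labelled:
  "\<not> mono_labelled a s \<Longrightarrow> normal s \<Longrightarrow> \<exists>b u v. b \<noteq> a \<and> rot_eq s (Node b u v)"
proof (induction s)
  case (Node c l r)
  show ?case
  proof (cases "c = a")
    case True
    then obtain b u v where b: "b \<noteq> a" "rot_eq r (Node b u v)"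
      using Node by auto
    then have "rot_eq (Node a l r) (Node b (Node a l u) v)"
      by (metis rot_eq.refl rot_eq.node rot_eq.rotate rot_eq.trans)
    then show ?thesis using True b by blast
  qed (use rot_eq.refl in blast)
qed simp

text \<open>
  Two vertices with equal labels can be rotated past each other if the tree between them
  can be given a root with another label.
\<close>

lemma rot_eq_rotate_same:
  assumes "\<not> mono_labelled a s" "normal s"
  shows "rot_eq (Node a (Node a u s) r) (Node a u (Node a s r))"
proof -
  obtain b v w where b: "b \<noteq> a" "rot_eq s (Node b v w)"
    using rot_eq_root_if_not_mono_labelled[OF assms] by blast
  \<comment> \<open>Mac Lane's pentagon on the subtrees \<open>u\<close>, \<open>v\<close>,
    \<open>w\<close>, \<open>r\<close>: the wanted edge joins two vertices labelled
    \<open>a\<close>, while each of the other four edges rotates an \<open>a\<close> past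
    \<open>b\<close>.\<close>
  have "rot_eq (Node a (Node a u s) r) (Node a (Node a u (Node b v w)) r)"
    by (intro rot_eq.node rot_eq.refl b)
  also have "rot_eq \<dots> (Node a (Node b (Node a u v) w) r)"
    by (intro rot_eq.node rot_eq.refl rot_eq.rotate) (use b in auto)
  also have "rot_eq \<dots> (Node b (Node a u v) (Node a w r))"
    by (intro rot_eq.sym[OF rot_eq.rotate] b)
  also have "rot_eq \<dots> (Node a u (Node b v (Node a w r)))"
    by (rule rot_eq.sym[OF rot_eq.rotate]) (use b in auto)
  also have "rot_eq \<dots> (Node a u (Node a (Node b v w) r))"
    by (intro rot_eq.node rot_eq.refl rot_eq.rotate b)
  also have "rot_eq \<dots> (Node a u (Node a s r))"
    by (intro rot_eq.node rot_eq.refl rot_eq.sym[OF b(2)])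
  finally show ?thesis .
qed

text \<open>Each unfolding of \<open>norm_node\<close> is a rotation if \<open>b\<close> differs
  from \<open>a\<close>. If \<open>b = a\<close>, then \<open>u\<close> is purely \<open>a\<close>
  by normality, so another label lies in \<open>s\<close> and \<open>rot_eq_rotate_same\<close>
  applies.\<close>

lemma rot_eq_norm_node: "normal l \<Longrightarrow> rot_eq (Node a l r) (norm_node a l r)"
proof (induction l)
  case (Node b u s)
  show ?case
  proof (cases "mono_labelled a (Node b u s)")
    case False
    have "rot_eq (Node a (Node b u s) r) (Node b u (Node a s r))"
    proof (cases "b = a")
      case True
      then show ?thesis using False Node.prems by (auto intro: rot_eq_rotate_same)
    qed (intro rot_eq.sym[OF rot_eq.rotate])
    moreover have "rot_eq (Node b u (Node a s r)) (Node b u (norm_node a s r))"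
      using Node by (intro rot_eq.node rot_eq.refl) auto
    ultimately show ?thesis using False by (auto intro: rot_eq.trans)
  qed (auto intro: rot_eq.refl)
qed (auto intro: rot_eq.refl)

lemma rot_eq_nf: "rot_eq t (nf t)"
proof (induction t)
  case (Node a l r)
  then have "rot_eq (Node a l r) (Node a (nf l) (nf r))"
    by (rule rot_eq.node)
  also have "rot_eq \<dots> (norm_node a (nf l) (nf r))"
    by (intro rot_eq_norm_node normal_nf)
  finally show ?case by simp
qed (simp add: rot_eq.refl)

text \<open>Rotations preserve arities and the order of the leaves, so the \<open>i\<close>-th leaf
  lies in corresponding subtrees on both sides.\<close>

lemma rot_eq_graft_left: "rot_eq s s' \<Longrightarrow> rot_eq (graft s i t) (graft s' i t)"
proof (induction arbitrary: i rule: rot_eq.induct)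
  case (node l l' r r' a)
  then show ?case
    using arity_rot_eq[OF node.hyps(1)] by (auto intro: rot_eq.node)
next
  case (rotate a b x y z)
  then show ?case
    by (auto intro: rot_eq.rotate simp: le_diff_conv not_le)
qed (auto intro: rot_eq.intros)

lemma rot_eq_graft_right: "rot_eq t t' \<Longrightarrow> rot_eq (graft s i t) (graft s i t')"
  by (induction s arbitrary: i) (auto intro: rot_eq.intros)


section \<open>The ideal is spanned by differences of equivalent trees\<close>

abbreviation tree_vec :: "'g mon \<Rightarrow> ('g, 'k::field) free_op" where
  "tree_vec t \<equiv> Poly_Mapping.single t 1"

definition lin_ext :: "('g mon \<Rightarrow> ('h, 'k::field) free_op) \<Rightarrow> ('g, 'k) free_op \<Rightarrow> ('h, 'k) free_op"
  where "lin_ext \<phi> f = (\<Sum>t \<in> Poly_Mapping.keys f. free_scale (Poly_Mapping.lookup f t) (\<phi> t))"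

text \<open>Lets elements with different supports be summed over one common index set.\<close>

lemma lin_ext_superset:
  assumes "finite A" "Poly_Mapping.keys f \<subseteq> A"
  shows "lin_ext \<phi> f = (\<Sum>t \<in> A. free_scale (Poly_Mapping.lookup f t) (\<phi> t))"
  unfolding lin_ext_def using assms
  by (intro sum.mono_neutral_left) (auto simp: in_keys_iff)

lemma module_hom_lin_ext:
  fixes \<phi> :: "'g mon \<Rightarrow> ('h, 'k::field) free_op"
  shows "module_hom free_scale free_scale (lin_ext \<phi>)"
proof (unfold_locales)
  fix f g :: "('g, 'k) free_op" and c :: 'k
  let ?A = "Poly_Mapping.keys f \<union> Poly_Mapping.keys g"
  show "lin_ext \<phi> (f + g) = lin_ext \<phi> f + lin_ext \<phi> g"
    using keys_add[of f g]
    by (simp add: lin_ext_superset[of ?A] lookup_add free_op.scale_left_distrib sum.distrib)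
  have "Poly_Mapping.keys (free_scale c f) \<subseteq> Poly_Mapping.keys f"
    by (auto simp: in_keys_iff)
  then show "lin_ext \<phi> (free_scale c f) = free_scale c (lin_ext \<phi> f)"
    by (simp add: lin_ext_superset[of "Poly_Mapping.keys f"] free_op.scale_sum_right)
qed

lemmas lin_ext_diff = module_hom_lin_ext[THEN module_hom.diff]

lemma lin_ext_single [simp]: "lin_ext \<phi> (tree_vec t) = \<phi> t"
  by (simp add: lin_ext_def)

lemma free_scale_single [simp]:
  "free_scale c (Poly_Mapping.single t d) = Poly_Mapping.single t (c * d)"
  by (rule poly_mapping_eqI) (simp add: lookup_single when_def)

lemma free_op_eq_sum:
  "f = (\<Sum>t \<in> Poly_Mapping.keys f. free_scale (Poly_Mapping.lookup f t) (tree_vec t))"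
  by (rule poly_mapping_eqI)
    (auto simp: lookup_sum lookup_single when_def in_keys_iff if_distrib cong: if_cong)

lemma free_comp_eq_lin_ext:
  "free_comp f i g = lin_ext (\<lambda>s. lin_ext (\<lambda>t. tree_vec (graft s i t)) g) f"
  by (simp add: free_comp_def lin_ext_def free_op.scale_sum_right)

lemma free_comp_single_single [simp]:
  "free_comp (tree_vec s) i (tree_vec t) = (tree_vec (graft s i t) :: ('g, 'k::field) free_op)"
  by (simp add: free_comp_eq_lin_ext)

lemma module_hom_free_comp_left:
  "module_hom free_scale free_scale (\<lambda>f. free_comp f i g)"
  unfolding free_comp_eq_lin_ext by (rule module_hom_lin_ext)

lemma module_hom_free_comp_right:
  fixes f :: "('g, 'k::field) free_op"
  shows "module_hom free_scale free_scale (\<lambda>g. free_comp f i g)"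
proof -
  have *: "free_comp f i g = (\<Sum>s \<in> Poly_Mapping.keys f. free_scale (Poly_Mapping.lookup f s)
      (lin_ext (\<lambda>t. tree_vec (graft s i t)) g))" for g
    by (simp add: free_comp_eq_lin_ext lin_ext_def)
  have 1: "lin_ext \<phi> (x + y) = lin_ext \<phi> x + lin_ext \<phi> y"
    and 2: "lin_ext \<phi> (free_scale c x) = free_scale c (lin_ext \<phi> x)"
    for \<phi> :: "'g mon \<Rightarrow> ('g, 'k) free_op" and x y c
    by (rule module_hom.add[OF module_hom_lin_ext]
             module_hom.scale[OF module_hom_lin_ext])+
  show ?thesis
    by unfold_locales
      (simp_all add: * 1 2 sum.distrib free_op.scale_right_distrib free_op.scale_sum_right
         mult.commute)
qed

lemmas free_comp_diff =
  module_hom_free_comp_left[THEN module_hom.diff]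
  module_hom_free_comp_right[THEN module_hom.diff]

lemma tree_vec_in_component: "arity t = n \<Longrightarrow> tree_vec t \<in> free_component n"
  by (simp add: free_component_def)

section \<open>The ideal compared with the span of rotation differences\<close>

lemma in_operad_ideal_rotate:
  assumes "a \<noteq> b"
  shows "in_operad_ideal bicom_relators (arity x + arity y + arity z)
    (tree_vec (Node a x (Node b y z)) - tree_vec (Node b (Node a x y) z)
      :: (bicom_gen, 'k::field) free_op)"
proof -
  let ?I = "in_operad_ideal bicom_relators :: nat \<Rightarrow> (bicom_gen, 'k) free_op \<Rightarrow> bool"
  let ?r = "tree_vec (Node a Leaf (Node b Leaf Leaf)) - tree_vec (Node b (Node a Leaf Leaf) Leaf)
    :: (bicom_gen, 'k) free_op"
  have "?r \<in> bicom_relators 3"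
    using assms by (cases a; cases b) (auto simp: bicom_relators_def)
  then have "?I 3 ?r" by (rule in_operad_ideal.relator)
  \<comment> \<open>The leaves of the relator are filled from right to left, so that the positions
    of the remaining leaves do not shift.\<close>
  then have "?I (3 + arity z - 1) (free_comp ?r 3 (tree_vec z))"
    by (rule in_operad_ideal.comp_left) (auto intro: tree_vec_in_component)
  then have "?I (3 + arity z - 1 + arity y - 1)
      (free_comp (free_comp ?r 3 (tree_vec z)) 2 (tree_vec y))"
    by (rule in_operad_ideal.comp_left) (auto intro: tree_vec_in_component)
  then have "?I (3 + arity z - 1 + arity y - 1 + arity x - 1)
      (free_comp (free_comp (free_comp ?r 3 (tree_vec z)) 2 (tree_vec y)) 1 (tree_vec x))"
    by (rule in_operad_ideal.comp_left) (auto intro: tree_vec_in_component)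
  moreover have "3 + arity z - 1 + arity y - 1 + arity x - 1 = arity x + arity y + arity z"
    by simp
  ultimately show ?thesis
    by (simp add: free_comp_diff ac_simps)
qed

lemma in_operad_ideal_rot_eq:
  "rot_eq s t \<Longrightarrow> in_operad_ideal bicom_relators (arity s)
     (tree_vec s - tree_vec t :: (bicom_gen, 'k::field) free_op)"
proof (induction rule: rot_eq.induct)
  case (refl s)
  then show ?case by (simp add: in_operad_ideal.zero)
next
  case (sym s t)
  have "free_scale (-1) (tree_vec s - tree_vec t) = (tree_vec t - tree_vec s :: (_, 'k) free_op)"
    by (simp add: free_op.scale_right_diff_distrib single_uminus)
  then show ?case
    using in_operad_ideal.scale[OF sym.IH, of "-1"] arity_rot_eq[OF sym.hyps] by simp
next
  case (trans s t u)
  then show ?case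
    using in_operad_ideal.add[OF trans.IH(1)] arity_rot_eq[OF trans.hyps(1)] by fastforce
next
  case (node l l' r r' a)
  \<comment> \<open>The subtrees are exchanged one at a time, through the intermediate tree
    \<open>Node a l' r\<close>; each difference is an ideal element plugged into a single
    leaf.\<close>
  have 1: "in_operad_ideal bicom_relators (1 + arity r + arity l - 1)
      (free_comp (tree_vec (Node a Leaf r)) 1 (tree_vec l - tree_vec l' :: (_, 'k) free_op))"
    by (rule in_operad_ideal.comp_right[OF _ node.IH(1)]) (auto intro: tree_vec_in_component)
  have 2: "in_operad_ideal bicom_relators (arity l' + 1 + arity r - 1)
      (free_comp (tree_vec (Node a l' Leaf)) (arity l' + 1)
        (tree_vec r - tree_vec r' :: (_, 'k) free_op))"
    by (rule in_operad_ideal.comp_right[OF _ node.IH(2)]) (auto intro: tree_vec_in_component)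
  show ?case
    using in_operad_ideal.add[OF 1[unfolded free_comp_diff free_comp_single_single]]
      2[unfolded free_comp_diff free_comp_single_single] arity_rot_eq[OF node.hyps(1)]
    by (fastforce simp: add.commute)
next
  case (rotate a b x y z)
  then show ?case using in_operad_ideal_rotate[of a b x y z] by (simp add: add.assoc)
qed

text \<open>For the two generators these span the ideal: \<open>in_operad_ideal_rot_eq\<close> gives
  one inclusion and \<open>bicom_ideal_subset\<close> the other.\<close>

definition rot_diff :: "('g, 'k::field) free_op set" where
  "rot_diff = {tree_vec s - tree_vec t | s t. rot_eq s t}"

text \<open>By linearity \<open>f\<close> may be taken to be one difference of equivalent trees.
  Expanding \<open>g\<close> into trees then gives a combination of differences of grafted trees,
  which are again equivalent.\<close>

lemma free_comp_rot_diff_left: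
  assumes "f \<in> free_op.span rot_diff"
  shows "free_comp f i g \<in> free_op.span rot_diff"
  using assms
proof (induction f rule: free_op.span_induct)
  case base
  show ?case
    by (intro module_hom.subspace_vimage[OF module_hom_free_comp_left, unfolded vimage_def]) simp
next
  case (step f)
  then obtain s t where st: "rot_eq s t" "f = tree_vec s - tree_vec t"
    by (auto simp: rot_diff_def)
  have "free_comp f i g = (\<Sum>u \<in> Poly_Mapping.keys g. free_scale (Poly_Mapping.lookup g u)
      (tree_vec (graft s i u) - tree_vec (graft t i u)))"
    by (simp add: st free_comp_diff free_comp_eq_lin_ext lin_ext_diff)
      (simp add: lin_ext_def sum_subtractf free_op.scale_right_diff_distrib)
  also have "\<dots> \<in> free_op.span rot_diff"
    using rot_eq_graft_left[OF st(1)]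
    by (intro free_op.span_sum free_op.span_scale free_op.span_base) (auto simp: rot_diff_def)
  finally show ?case .
qed

lemma free_comp_rot_diff_right:
  assumes "g \<in> free_op.span rot_diff"
  shows "free_comp f i g \<in> free_op.span rot_diff"
  using assms
proof (induction g rule: free_op.span_induct)
  case base
  show ?case
    by (intro module_hom.subspace_vimage[OF module_hom_free_comp_right, unfolded vimage_def]) simp
next
  case (step g)
  then obtain s t where st: "rot_eq s t" "g = tree_vec s - tree_vec t"
    by (auto simp: rot_diff_def)
  have "free_comp f i g = (\<Sum>u \<in> Poly_Mapping.keys f. free_scale (Poly_Mapping.lookup f u)
      (tree_vec (graft u i s) - tree_vec (graft u i t)))"
    by (simp add: st free_comp_eq_lin_ext lin_ext_diff)
      (simp add: lin_ext_def)
  also have "\<dots> \<in> free_op.span rot_diff"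
    using rot_eq_graft_right[OF st(1)]
    by (intro free_op.span_sum free_op.span_scale free_op.span_base) (auto simp: rot_diff_def)
  finally show ?case .
qed

lemma bicom_relators_subset_rot_diff: "bicom_relators n \<subseteq> rot_diff"
  unfolding bicom_relators_def rot_diff_def
  by (auto intro!: exI rot_eq.rotate)

lemma in_operad_ideal_imp_rot_diff:
  "in_operad_ideal bicom_relators n f \<Longrightarrow> f \<in> free_op.span rot_diff"
  by (induction rule: in_operad_ideal.induct)
    (use bicom_relators_subset_rot_diff in \<open>auto intro: free_op.span_base free_op.span_zero
      free_op.span_add free_op.span_scale free_comp_rot_diff_left free_comp_rot_diff_right\<close>)

lemma bicom_ideal_subset: "bicom_ideal \<subseteq> free_op.span rot_diff"
  unfolding bicom_ideal_def
  by (intro free_op.span_minimal) (auto simp: operad_ideal_def in_operad_ideal_imp_rot_diff)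

lemma rot_eq_imp_bicom_rel: "rot_eq s t \<Longrightarrow> bicom_rel (tree_vec s) (tree_vec t)"
  unfolding bicom_rel_def bicom_ideal_def operad_ideal_def
  using in_operad_ideal_rot_eq by (intro free_op.span_base) blast

text \<open>A linear retraction onto the span of the normal trees that vanishes on the ideal; it
  separates normal trees in the quotient.\<close>

definition lin_nf :: "('g, 'k::field) free_op \<Rightarrow> ('g, 'k) free_op" where
  "lin_nf = lin_ext (\<lambda>t. tree_vec (nf t))"

lemma module_hom_lin_nf: "module_hom free_scale free_scale lin_nf"
  unfolding lin_nf_def by (rule module_hom_lin_ext)

lemma lin_nf_rot_diff:
  assumes "f \<in> free_op.span rot_diff"
  shows "lin_nf f = 0"
proof (rule module_hom.eq_0_on_span[OF module_hom_lin_nf _ assms])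
  show "lin_nf x = 0" if "x \<in> rot_diff" for x :: "('a, 'b) free_op"
    using that nf_rot_eq by (fastforce simp: rot_diff_def lin_nf_def lin_ext_diff)
qed


section \<open>A basis of each component\<close>

definition normal_trees :: "nat \<Rightarrow> 'g mon set" where
  "normal_trees n = {t. normal t \<and> arity t = n}"

lemma independent_tree_vec: "free_op.independent (tree_vec ` X :: ('g, 'k::field) free_op set)"
  unfolding free_op.dependent_def
proof safe
  fix t :: "'g mon"
  assume t: "tree_vec t \<in> free_op.span (tree_vec ` X - {tree_vec t :: ('g, 'k) free_op})"
  \<comment> \<open>The coefficient at \<open>t\<close> is a linear functional that kills all the
    other trees but is 1 on \<open>t\<close>.\<close>
  have "Poly_Mapping.lookup f t = 0"
    if "f \<in> free_op.span (tree_vec ` X - {tree_vec t})" for f :: "('g, 'k) free_op"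
    using that
  proof (induction f rule: free_op.span_induct)
    case base
    show ?case by (rule free_op.subspaceI) (auto simp: lookup_add)
  next
    case (step f)
    then show ?case by (auto simp: lookup_single when_def)
  qed
  from this[OF t] show False by simp
qed

lemma module_hom_abs_noncom_bicom:
  "module_hom free_scale noncom_bicom_scale abs_noncom_bicom"
  by unfold_locales (simp_all add: plus_noncom_bicom.abs_eq noncom_bicom_scale.abs_eq)

lemma lin_nf_normal:
  assumes "\<And>t. t \<in> X \<Longrightarrow> normal t" "f \<in> free_op.span (tree_vec ` X)"
  shows "lin_nf f = f"
  using assms(2)
proof (induction f rule: free_op.span_induct)
  case base
  show ?case
    by (rule free_op.subspaceI)
      (simp_all add: module_hom.add[OF module_hom_lin_nf]
        module_hom.scale[OF module_hom_lin_nf] module_hom.zero[OF module_hom_lin_nf])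
next
  case (step f)
  then show ?case using assms(1) by (auto simp: lin_nf_def nf_normal)
qed

text \<open>A difference lying in the ideal is killed by \<open>lin_nf\<close>, yet
  \<open>lin_nf\<close> fixes combinations of normal trees.\<close>

lemma inj_on_abs_normal:
  "inj_on abs_noncom_bicom (free_op.span (tree_vec ` normal_trees n))"
proof (rule inj_onI)
  fix f g :: "(bicom_gen, 'k::field) free_op"
  assume fg: "f \<in> free_op.span (tree_vec ` normal_trees n)"
    "g \<in> free_op.span (tree_vec ` normal_trees n)"
    and "abs_noncom_bicom f = abs_noncom_bicom g"
  then have "f - g \<in> bicom_ideal"
    by (simp add: noncom_bicom.abs_eq_iff bicom_rel_def)
  then have "lin_nf (f - g) = 0"
    using bicom_ideal_subset lin_nf_rot_diff by blast
  moreover have "lin_nf (f - g) = f - g"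
    by (rule lin_nf_normal[of "normal_trees n"])
      (auto simp: normal_trees_def intro!: free_op.span_diff fg[unfolded normal_trees_def])
  ultimately show "f = g" by simp
qed

text \<open>Every tree has the same class and the same arity as its normal form.\<close>

lemma noncom_bicom_component_eq_span:
  "noncom_bicom_component n =
     (noncom_bicom.span (abs_noncom_bicom ` tree_vec ` normal_trees n) :: 'k::field noncom_bicom set)"
  (is "_ = ?S")
proof
  show "noncom_bicom_component n \<subseteq> ?S"
  proof
    fix x :: "'k noncom_bicom"
    assume "x \<in> noncom_bicom_component n"
    then obtain f where f: "f \<in> free_component n" "x = abs_noncom_bicom f"
      by (auto simp: noncom_bicom_component_def)
    have "x = (\<Sum>t \<in> Poly_Mapping.keys f. noncom_bicom_scale (Poly_Mapping.lookup f t)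
        (abs_noncom_bicom (tree_vec t)))"
      unfolding f(2)
      by (subst free_op_eq_sum)
        (simp only: module_hom.sum[OF module_hom_abs_noncom_bicom]
          noncom_bicom_scale.abs_eq)
    also have "\<dots> \<in> ?S"
    proof (intro noncom_bicom.span_sum noncom_bicom.span_scale noncom_bicom.span_base)
      fix t assume "t \<in> Poly_Mapping.keys f"
      then have "nf t \<in> normal_trees n"
        using f(1) arity_rot_eq[OF rot_eq_nf, of t]
        by (auto simp: free_component_def normal_trees_def normal_nf)
      moreover have "abs_noncom_bicom (tree_vec t)
          = (abs_noncom_bicom (tree_vec (nf t)) :: 'k noncom_bicom)"
        by (simp add: noncom_bicom.abs_eq_iff rot_eq_imp_bicom_rel rot_eq_nf)
      ultimately show "(abs_noncom_bicom (tree_vec t) :: 'k noncom_bicom)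
          \<in> abs_noncom_bicom ` tree_vec ` normal_trees n"
        by auto
    qed
    finally show "x \<in> ?S" .
  qed
  show "?S \<subseteq> noncom_bicom_component n"
    by (intro noncom_bicom.span_minimal subspace_noncom_bicom_component)
      (auto simp: noncom_bicom_component_def normal_trees_def intro!: imageI tree_vec_in_component)
qed

lemma dim_noncom_bicom_component:
  "noncom_bicom.dim (noncom_bicom_component n :: 'k::field noncom_bicom set)
     = card (normal_trees n :: bicom_gen mon set)"
proof -
  let ?T = "tree_vec ` normal_trees n :: (bicom_gen, 'k) free_op set"
  have "noncom_bicom.independent (abs_noncom_bicom ` ?T)"
    by (rule module_hom.independent_injective_image[OF module_hom_abs_noncom_bicom
          independent_tree_vec inj_on_abs_normal])
  then have "noncom_bicom.dim (noncom_bicom_component n :: 'k noncom_bicom set)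
      = card (abs_noncom_bicom ` ?T)"
    by (intro noncom_bicom.dim_eq_card)
      (simp_all add: noncom_bicom_component_eq_span noncom_bicom.span_span)
  also have "\<dots> = card ?T"
    by (intro card_image inj_on_subset[OF inj_on_abs_normal]) (rule free_op.span_superset)
  also have "\<dots> = card (normal_trees n :: bicom_gen mon set)"
    by (intro card_image inj_onI) (metis lookup_single_eq lookup_single_not_eq zero_neq_one)
  finally show ?thesis .
qed


section \<open>Counting normal trees\<close>

lemma finite_trees: "finite {t :: 'g::finite mon. arity t = n}"
proof (induction n rule: less_induct)
  case (less n)
  let ?T = "\<Union>k<n. {t :: 'g mon. arity t = k}"
  have "{t :: 'g mon. arity t = n} \<subseteq> insert Leaf ((\<lambda>(a, l, r). Node a l r) ` (UNIV \<times> ?T \<times> ?T))"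
  proof
    fix t :: "'g mon"
    assume "t \<in> {t. arity t = n}"
    then show "t \<in> insert Leaf ((\<lambda>(a, l, r). Node a l r) ` (UNIV \<times> ?T \<times> ?T))"
      using arity_pos by (cases t) (auto simp: image_iff)
  qed
  moreover have "finite ?T" using less by blast
  ultimately show ?case by (meson finite_SigmaI finite_imageI finite_insert finite_subset finite_UNIV)
qed

text \<open>Splits a tree at its root. Keeping separate predicates for the left and the right
  subtree lets one recursion serve both the trees with a single label and the normal trees.\<close>

lemma card_trees_rec:
  fixes P :: "'g::finite \<Rightarrow> 'g mon \<Rightarrow> bool"
  assumes Q: "\<And>a l r. Q (Node a l r) \<longleftrightarrow> P a l \<and> Q r"
  shows "card {t. Q t \<and> arity t = Suc (Suc k)} =
    (\<Sum>a\<in>UNIV. \<Sum>i\<le>k. card {t. P a t \<and> arity t = Suc i} * card {t. Q t \<and> arity t = Suc (k - i)})"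
proof -
  let ?A = "\<lambda>a i. {t. P a t \<and> arity t = Suc i}"
  let ?B = "\<lambda>i. {t. Q t \<and> arity t = Suc i}"
  have "{t. Q t \<and> arity t = Suc (Suc k)} =
      (\<lambda>(a, i, l, r). Node a l r) ` (SIGMA a:UNIV. SIGMA i:{..k}. ?A a i \<times> ?B (k - i))"
    (is "?L = ?f ` ?R")
  proof (intro equalityI subsetI)
    fix t assume t: "t \<in> ?L"
    then obtain a l r where lr: "t = Node a l r" by (cases t) auto
    then have "(a, arity l - 1, l, r) \<in> ?R"
      using t arity_pos[of l] arity_pos[of r] by (auto simp: Q)
    then show "t \<in> ?f ` ?R" using lr by force
  qed (auto simp: Q)
  moreover have "inj_on ?f ?R" by (auto simp: inj_on_def)
  moreover have fin: "finite (?A a i)" "finite (?B i)" for a i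
    by (rule finite_subset[OF _ finite_trees], auto)+
  ultimately show ?thesis
    by (simp add: card_image card_SigmaI finite_SigmaI card_cartesian_product)
qed

text \<open>Indexed by the number of inner vertices, one less than the arity, so that the generating
  series has constant term 1. These are the Catalan numbers.\<close>

definition mono_count :: "bicom_gen \<Rightarrow> nat \<Rightarrow> nat" where
  "mono_count a k = card {t. mono_labelled a t \<and> arity t = Suc k}"

definition normal_count :: "nat \<Rightarrow> nat" where
  "normal_count k = card (normal_trees (Suc k) :: bicom_gen mon set)"

lemma arity_Suc_0: "arity t = Suc 0 \<longleftrightarrow> t = Leaf"
  by (cases t) (auto simp: add_is_1 arity_pos[THEN gr_implies_not0])

lemma UNIV_bicom_gen: "UNIV = {Prec, Succ}"
  using bicom_gen.exhaust by auto

instance bicom_gen :: finite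
  by standard (simp add: UNIV_bicom_gen)

lemma mono_count_0: "mono_count a 0 = 1"
proof -
  have "{t. mono_labelled a t \<and> arity t = Suc 0} = {Leaf}"
    by (auto simp: arity_Suc_0)
  then show ?thesis by (simp add: mono_count_def)
qed

lemma normal_count_0: "normal_count 0 = 1"
proof -
  have "normal_trees (Suc 0) = {Leaf :: bicom_gen mon}"
    by (auto simp: normal_trees_def arity_Suc_0)
  then show ?thesis by (simp add: normal_count_def)
qed

lemma mono_count_Suc: "mono_count c (Suc k) = (\<Sum>i\<le>k. mono_count c i * mono_count c (k - i))"
  using card_trees_rec[of "mono_labelled c" "\<lambda>a t. a = c \<and> mono_labelled c t" k]
  by (cases c) (simp_all add: UNIV_bicom_gen mono_count_def)

text \<open>Merges the contributions of the two root labels into the factor 2 of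
  \<open>normal_count_Suc\<close>.\<close>

lemma mono_count_eq: "mono_count a k = mono_count b k"
proof (induction k rule: less_induct)
  case (less k)
  then show ?case
    by (cases k) (auto simp: mono_count_0 mono_count_Suc intro!: sum.cong)
qed

lemma normal_count_Suc:
  "normal_count (Suc k) = 2 * (\<Sum>i\<le>k. mono_count Prec i * normal_count (k - i))"
  using card_trees_rec[of "normal :: bicom_gen mon \<Rightarrow> bool" mono_labelled k]
  by (simp add: UNIV_bicom_gen mono_count_def[symmetric] normal_count_def normal_trees_def
      mono_count_eq[of Succ _ Prec] mult_2)

section \<open>Generating functions and the closed formula\<close>

lemma normal_count_fps_square:
  defines "N \<equiv> Abs_fps (\<lambda>k. real (normal_count k))"
  shows "N\<^sup>2 * (1 - 4 * fps_X) = 1"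
proof -
  define C where "C = Abs_fps (\<lambda>k. real (mono_count Prec k))"
  have C: "C = 1 + fps_X * C\<^sup>2"
  proof (rule fps_ext)
    fix k show "fps_nth C k = fps_nth (1 + fps_X * C\<^sup>2) k"
    proof (cases k)
      case (Suc m)
      have "fps_nth (1 + fps_X * C\<^sup>2) k = fps_nth (C * C) m"
        using Suc by (simp add: power2_eq_square)
      then show ?thesis
        using Suc by (simp add: C_def mono_count_Suc fps_mult_nth atLeast0AtMost)
    qed (simp add: C_def mono_count_0)
  qed
  have N: "N = 1 + 2 * fps_X * C * N"
  proof (rule fps_ext)
    fix k show "fps_nth N k = fps_nth (1 + 2 * fps_X * C * N) k"
    proof (cases k)
      case (Suc m)
      have eq: "2 * fps_X * C * N = fps_X * (C * N) + fps_X * (C * N)"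
        by (simp add: algebra_simps)
      have "fps_nth (1 + 2 * fps_X * C * N) k = fps_nth (C * N) m + fps_nth (C * N) m"
        unfolding eq Suc fps_add_nth by simp
      then show ?thesis
        using Suc by (simp add: N_def C_def normal_count_Suc fps_mult_nth atLeast0AtMost)
    qed (simp add: N_def normal_count_0 mult.assoc)
  qed
  \<comment> \<open>Completing the square in the quadratic equation for \<open>C\<close> shows that
    \<open>1 - 2 * fps_X * C\<close>, the inverse of \<open>N\<close>, is a square root of
    \<open>1 - 4 * fps_X\<close>.\<close>
  have "(1 - 2 * fps_X * C)\<^sup>2 = 1 - 4 * fps_X * (C - fps_X * C\<^sup>2)"
    by (simp add: power2_eq_square algebra_simps)
  also have "C - fps_X * C\<^sup>2 = 1" using C by (metis add_diff_cancel_right')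
  finally have "1 - 4 * fps_X = (1 - 2 * fps_X * C)\<^sup>2" by simp
  then have "N\<^sup>2 * (1 - 4 * fps_X) = (N * (1 - 2 * fps_X * C))\<^sup>2"
    by (simp add: power_mult_distrib)
  also have "N * (1 - 2 * fps_X * C) = 1"
    using N by (simp add: algebra_simps)
  finally show ?thesis by simp
qed

lemma normal_count_rec: "real (Suc m) * normal_count (Suc m) = (4 * m + 2) * normal_count m"
proof -
  define N where "N = Abs_fps (\<lambda>k. real (normal_count k))"
  have sq: "N\<^sup>2 * (1 - 4 * fps_X) = 1"
    unfolding N_def by (rule normal_count_fps_square)
  have N0: "N \<noteq> 0" using sq by auto
  have "fps_deriv (N\<^sup>2 * (1 - 4 * fps_X)) = 0"
    unfolding sq by simp
  \<comment> \<open>The product rule leaves a common factor \<open>2 * N\<close>, which can be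
    cancelled because power series over the reals have no zero divisors.\<close>
  then have "2 * N * (fps_deriv N * (1 - 4 * fps_X) - 2 * N) = 0"
    by (simp add: power2_eq_square algebra_simps)
  then have "fps_deriv N * (1 - 4 * fps_X) = 2 * N"
    using N0 by simp
  then have "fps_deriv N = 2 * N + 4 * (fps_X * fps_deriv N)"
    by (simp add: algebra_simps)
  \<comment> \<open>At index \<open>m\<close> the left side is \<open>(m + 1)\<close> times the next
    coefficient, and \<open>fps_X * fps_deriv N\<close> contributes \<open>m\<close> times the
    current one.\<close>
  then have "fps_nth (fps_deriv N) m = fps_nth (2 * N + 4 * (fps_X * fps_deriv N)) m"
    by simp
  then show ?thesis
    by (cases m) (simp_all add: N_def numeral_fps_const algebra_simps)
qed

lemma normal_count_eq: "real (normal_count m) = fact (2 * m) / (fact m * fact m)"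
proof (induction m)
  case (Suc m)
  have "real (normal_count (Suc m)) = (4 * m + 2) * real (normal_count m) / real (Suc m)"
    using normal_count_rec[of m] by (simp add: field_simps)
  \<comment> \<open>Extending the fraction by \<open>m + 1\<close> turns \<open>4 * m + 2\<close>
    into \<open>(2 * m + 2) * (2 * m + 1)\<close>, the two factors that take
    \<open>fact (2 * m)\<close> to \<open>fact (2 * m + 2)\<close>.\<close>
  also have "\<dots> = (2 * real m + 2) * (2 * real m + 1) * fact (2 * m)
      / ((real (Suc m) * fact m) * (real (Suc m) * fact m))"
  proof -
    have "2 * d * (F / (f * f)) / a = 2 * a * d * F / ((a * f) * (a * f))"
      if "a \<noteq> 0" "f \<noteq> 0" for a d f F :: real
      using that by (simp add: divide_simps)
    from this[of "real (Suc m)" "fact m" "2 * real m + 1" "fact (2 * m)"]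
    have "2 * (2 * real m + 1) * (fact (2 * m) / (fact m * fact m)) / real (Suc m)
        = 2 * real (Suc m) * (2 * real m + 1) * fact (2 * m)
          / ((real (Suc m) * fact m) * (real (Suc m) * fact m))"
      by simp
    moreover have "real (4 * m + 2) = 2 * (2 * real m + 1)" "2 * real m + 2 = 2 * real (Suc m)"
      by simp_all
    ultimately show ?thesis
      unfolding Suc.IH by presburger
  qed
  also have "\<dots> = fact (2 * Suc m) / (fact (Suc m) * fact (Suc m))"
    by (simp add: algebra_simps)
  finally show ?case .
qed (simp add: normal_count_0)

theorem theorem4p4:
  fixes n :: nat
  assumes "n \<ge> 1"
  shows "real (noncom_bicom.dim (noncom_bicom_component n :: 'k::field noncom_bicom set))
           = fact (2 * n - 2) / (fact (n - 1) * fact (n - 1))"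
proof -
  \<comment> \<open>Arity \<open>n\<close> means \<open>n - 1\<close> inner vertices; the truncated
    subtraction is exact since \<open>n\<close> is positive.\<close>
  have "normal_count (n - 1) = card (normal_trees n :: bicom_gen mon set)"
    using assms by (simp add: normal_count_def)
  then show ?thesis
    using normal_count_eq[of "n - 1"] by (simp add: dim_noncom_bicom_component diff_mult_distrib2)
qed

end
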